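(* For all $\theta,\alpha\in\mathbb C$ and $w\in\mathbb C$, the normalized confluent function $\mathbf F_{\theta,\alpha}$ satisfies the following six recurrence relations: $$\partial_w\mathbf F_{\theta,\alpha}(w)=\tfrac{1+\theta+\alpha}{2}\,\mathbf F_{\theta+1,\alpha+1}(w),$$ $$(w\partial_w+\alpha-w)\mathbf F_{\theta,\alpha}(w)=\mathbf F_{\theta-1,\alpha-1}(w),$$ $$(w\partial_w+\alpha)\mathbf F_{\theta,\alpha}(w)=\mathbf F_{\theta+1,\alpha-1}(w),$$ $$(\partial_w-1)\mathbf F_{\theta,\alpha}(w)=\tfrac{-1+\theta-\alpha}{2}\,\mathbf F_{\theta-1,\alpha+1}(w),$$ $$\Big(w\partial_w+\tfrac{1+\theta+\alpha}{2}\Big)\mathbf F_{\theta,\alpha}(w)=\tfrac{1+\theta+\alpha}{2}\,\mathbf F_{\theta+2,\alpha}(w),$$ $$\Big(w\partial_w+\tfrac{1-\theta+\alpha}{2}-w\Big)\mathbf F_{\theta,\alpha}(w)=\tfrac{1-\theta+\alpha}{2}\,\mathbf F_{\theta-2,\alpha}(w).$$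
   Context: For $a,c\in\mathbb C$ let $\mathbf F(a;c;w):=\sum_{n=0}^\infty\frac{(a)_n}{\Gamma(c+n)}\frac{w^n}{n!}$ (with $1/\Gamma$ equal to $0$ at the poles of $\Gamma$), where $(a)_n=a(a+1)\cdots(a+n-1)$. For $\theta,\alpha\in\mathbb C$ put $\mathbf F_{\theta,\alpha}(w):=\mathbf F\big(\tfrac{1+\alpha+\theta}{2};1+\alpha;w\big)$. *)

theory Defs
  imports "HOL-Analysis.Analysis"
begin

text \<open>The library's \<^const>\<open>rGamma\<close> is the entire reciprocal Gamma function, which vanishes
  at the poles of \<^const>\<open>Gamma\<close>.\<close>

definition confF :: "complex \<Rightarrow> complex \<Rightarrow> complex \<Rightarrow> complex" where
  "confF a c w = (\<Sum>n. pochhammer a n * rGamma (c + of_nat n) * (w ^ n / fact n))"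

definition confF_par :: "complex \<Rightarrow> complex \<Rightarrow> complex \<Rightarrow> complex" where
  "confF_par \<theta> \<alpha> w = confF ((1 + \<alpha> + \<theta>) / 2) (1 + \<alpha>) w"

text \<open>The series converges for every argument and its sum is entire, so neither \<^const>\<open>suminf\<close>
  nor \<^const>\<open>deriv\<close> ever takes an unspecified value on these functions.\<close>

lemma summable_confF:
  fixes a c w :: complex
  shows "summable (\<lambda>n. pochhammer a n * rGamma (c + of_nat n) * (w ^ n / fact n))"
proof -
  define f where "f n = pochhammer a n * rGamma (c + of_nat n) * (w ^ n / fact n)" for n
  obtain N :: nat where N: "real N \<ge> 2 * norm c + norm a + 8 * norm w + 1"
    using real_arch_simple by blast
  have "norm (f (Suc n)) \<le> 1/2 * norm (f n)" if "n \<ge> N" for n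
  proof -
    have n: "real n \<ge> 2 * norm c + norm a + 8 * norm w + 1" using N that by linarith
    have lo: "norm (c + of_nat n) \<ge> real n / 2"
      using norm_triangle_ineq4[of "c + of_nat n" c] n
      by (simp add: norm_of_nat) (smt (verit) norm_ge_zero)
    have hi: "norm (a + of_nat n) \<le> 2 * real n"
      using norm_triangle_ineq[of a "of_nat n"] n
      by (simp add: norm_of_nat) (smt (verit) norm_ge_zero)
    have npos: "real n > 0" using n by (smt (verit) norm_ge_zero)
    have wn: "norm w \<le> real n / 8" using n norm_ge_zero[of c] norm_ge_zero[of a] by linarith
    have ne: "c + of_nat n \<noteq> 0" using lo npos by auto
    have r: "rGamma (c + of_nat n) = (c + of_nat n) * rGamma (c + of_nat (Suc n))"
      using rGamma_plus1[of "c + of_nat n"] by (simp add: add_ac)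
    have eq: "f (Suc n) * ((c + of_nat n) * of_nat (Suc n)) = f n * ((a + of_nat n) * w)"
      unfolding f_def r by (simp add: pochhammer_Suc divide_simps del: of_nat_Suc)
    have "norm (f (Suc n)) * (norm (c + of_nat n) * real (Suc n))
            = norm (f n) * (norm (a + of_nat n) * norm w)"
      using arg_cong[OF eq, of norm] by (simp only: norm_mult norm_of_nat)
    also have "\<dots> \<le> norm (f n) * (2 * real n * (real n / 8))"
      using wn by (intro mult_left_mono mult_mono hi) auto
    also have "\<dots> = norm (f n) * (1/2) * (real n / 2 * real n)" by simp
    also have "\<dots> \<le> norm (f n) * (1/2) * (norm (c + of_nat n) * real (Suc n))"
      by (intro mult_left_mono mult_mono lo) auto
    finally have "norm (f (Suc n)) * (norm (c + of_nat n) * real (Suc n))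
        \<le> norm (f n) * (1/2) * (norm (c + of_nat n) * real (Suc n))" .
    moreover have "norm (c + of_nat n) * real (Suc n) > 0" using ne by simp
    ultimately have "norm (f (Suc n)) \<le> norm (f n) * (1/2)"
      by (rule mult_right_le_imp_le)
    then show ?thesis by simp
  qed
  then have "summable f" by (intro summable_ratio_test[of "1/2" N f]) auto
  then show ?thesis unfolding f_def .
qed

lemma confF_field_differentiable: "confF a c field_differentiable at w"
proof -
  let ?k = "\<lambda>n. pochhammer a n * rGamma (c + of_nat n) / fact n"
  have "summable (\<lambda>n. ?k n * z ^ n)" for z
    using summable_confF[of a c z] by simp
  from termdiffs_strong_converges_everywhere[OF this]
  have "((\<lambda>z. \<Sum>n. ?k n * z ^ n) has_field_derivative (\<Sum>n. diffs ?k n * w ^ n)) (at w)" .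
  moreover have "confF a c = (\<lambda>z. \<Sum>n. ?k n * z ^ n)"
    by (auto simp: confF_def)
  ultimately show ?thesis by (auto simp: field_differentiable_def)
qed

lemma confF_par_field_differentiable: "confF_par \<theta> \<alpha> field_differentiable at w"
proof -
  have "confF_par \<theta> \<alpha> = confF ((1 + \<alpha> + \<theta>) / 2) (1 + \<alpha>)"
    by (simp add: confF_par_def fun_eq_iff)
  then show ?thesis by (simp add: confF_field_differentiable)
qed

end

theory Submission
  imports Defs
begin

text \<open>Write \<open>F(a; c)\<close> for \<open>confF a c w\<close>. All six relations are linear consequences of the derivative
  formula \<open>F'(a; c) = a F(a+1; c+1)\<close> and the two contiguous relations
  \<open>F(a+1; c) = F(a; c) + w F(a+1; c+1)\<close> and \<open>a F(a+1; c+1) = F(a; c) + (a - c) F(a; c+1)\<close>,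
  which hold coefficientwise.\<close>

lemma confF_sums:
  "(\<lambda>n. pochhammer a n * rGamma (c + of_nat n) * (w ^ n / fact n)) sums confF a c w"
  unfolding confF_def by (rule summable_sums[OF summable_confF])

text \<open>Termwise differentiation shifts the index by one. The shift turns c + n into (c + 1) +
  n, the factor n + 1 cancels against the factorial, and \<open>pochhammer_rec\<close> splits off a,
  the first factor of the rising factorial.\<close>

lemma deriv_confF: "deriv (confF a c) w = a * confF (a + 1) (c + 1) w"
proof -
  let ?k = "\<lambda>n. pochhammer a n * rGamma (c + of_nat n) / fact n"
  have "summable (\<lambda>n. ?k n * z ^ n)" for z
    using summable_confF[of a c z] by simp
  from termdiffs_strong_converges_everywhere[OF this]
  have "((\<lambda>z. \<Sum>n. ?k n * z ^ n) has_field_derivative (\<Sum>n. diffs ?k n * w ^ n)) (at w)" .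
  moreover have "confF a c = (\<lambda>z. \<Sum>n. ?k n * z ^ n)"
    by (auto simp: confF_def)
  ultimately have "deriv (confF a c) w = (\<Sum>n. diffs ?k n * w ^ n)"
    by (simp add: DERIV_imp_deriv)
  moreover have "diffs ?k n * w ^ n =
      a * (pochhammer (a + 1) n * rGamma (c + 1 + of_nat n) * (w ^ n / fact n))" for n
  proof -
    have c: "c + of_nat (Suc n) = c + 1 + of_nat n"
      by simp
    show ?thesis
      by (simp add: diffs_def pochhammer_rec c del: of_nat_Suc)
  qed
  ultimately show ?thesis
    using sums_unique[OF sums_mult[OF confF_sums[of "a + 1" "c + 1" w], of a]] by simp
qed

text \<open>The factor w shifts the index, so the coefficient of index n + 1 on the left is matched
  with that of index n on the right.\<close>

lemma confF_contiguous_upper: "confF (a + 1) c w = confF a c w + w * confF (a + 1) (c + 1) w"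
proof -
  let ?f = "\<lambda>a c n. pochhammer a n * rGamma (c + of_nat n) * (w ^ n / fact n)"
  have "?f (a + 1) c (Suc n) - ?f a c (Suc n) = w * ?f (a + 1) (c + 1) n" for n
  proof -
    have "pochhammer (a + 1) (Suc n) - pochhammer a (Suc n) = of_nat (Suc n) * pochhammer (a + 1) n"
      \<comment> \<open>Both rising factorials contain \<open>pochhammer (a + 1) n\<close>; the
        remaining factors are a + 1 + n and a, with difference n + 1. This difference later cancels
        against the factorial.\<close>
      by (subst (2) pochhammer_rec) (simp add: pochhammer_Suc algebra_simps)
    moreover have "?f (a + 1) c (Suc n) - ?f a c (Suc n) =
        (pochhammer (a + 1) (Suc n) - pochhammer a (Suc n)) *
          rGamma (c + of_nat (Suc n)) * (w ^ Suc n / fact (Suc n))"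
      by (simp only: left_diff_distrib)
    moreover have "c + of_nat (Suc n) = c + 1 + of_nat n"
      by simp
    moreover have "w ^ Suc n / fact (Suc n) = w * (w ^ n / fact n) / of_nat (Suc n)"
      by simp
    ultimately have "?f (a + 1) c (Suc n) - ?f a c (Suc n) =
        of_nat (Suc n) * pochhammer (a + 1) n * rGamma (c + 1 + of_nat n) *
          (w * (w ^ n / fact n) / of_nat (Suc n))"
      by (simp only:)
    then show ?thesis
      by (simp del: of_nat_Suc)
  qed
  then have "(\<lambda>n. ?f (a + 1) c (Suc n) - ?f a c (Suc n)) sums (w * confF (a + 1) (c + 1) w)"
    using sums_mult[OF confF_sums[of "a + 1" "c + 1" w], of w] by simp
  \<comment> \<open>Restoring the term of index 0 leaves the sum unchanged: both empty rising
    factorials equal 1, so this difference is 0.\<close>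
  then have "(\<lambda>n. ?f (a + 1) c n - ?f a c n) sums (w * confF (a + 1) (c + 1) w)"
    by (subst (asm) sums_Suc_iff) simp
  from sums_unique2[OF this sums_diff[OF confF_sums confF_sums]] show ?thesis
    by (simp add: algebra_simps)
qed

text \<open>Coefficientwise this is a + n = (c + n) + (a - c): the factor a + n extends the rising
  factorial, and c + n lowers the argument of \<open>rGamma\<close> by one. The recurrence of
  \<open>rGamma\<close> holds at the poles of \<open>Gamma\<close> too, so c is arbitrary.\<close>

lemma confF_contiguous_lower:
  "a * confF (a + 1) (c + 1) w = confF a c w + (a - c) * confF a (c + 1) w"
proof -
  have "a * (pochhammer (a + 1) n * rGamma (c + 1 + of_nat n) * (w ^ n / fact n)) =
      pochhammer a n * rGamma (c + of_nat n) * (w ^ n / fact n) +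
      (a - c) * (pochhammer a n * rGamma (c + 1 + of_nat n) * (w ^ n / fact n))" for n
  proof -
    have p: "a * pochhammer (a + 1) n = (a + of_nat n) * pochhammer a n"
      by (metis pochhammer_rec pochhammer_Suc mult.commute)
    have r: "rGamma (c + of_nat n) = (c + of_nat n) * rGamma (c + 1 + of_nat n)"
      using rGamma_plus1[of "c + of_nat n"] by (simp add: add_ac)
    have "a * (pochhammer (a + 1) n * rGamma (c + 1 + of_nat n) * (w ^ n / fact n)) =
        (a + of_nat n) * pochhammer a n * rGamma (c + 1 + of_nat n) * (w ^ n / fact n)"
      by (simp only: p mult.assoc[symmetric])
    then show ?thesis
      unfolding r by (simp only: algebra_simps)
  qed
  then show ?thesis
    using sums_unique2[OF sums_mult[OF confF_sums[of "a + 1" "c + 1" w], of a]]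
      sums_add[OF confF_sums[of a c w] sums_mult[OF confF_sums[of a "c + 1" w], of "a - c"]]
    by simp
qed

theorem mainTheorem4:
  fixes \<theta> \<alpha> w :: complex
  shows "(deriv (confF_par \<theta> \<alpha>) w = (1 + \<theta> + \<alpha>) / 2 * confF_par (\<theta> + 1) (\<alpha> + 1) w) \<and>
    (w * deriv (confF_par \<theta> \<alpha>) w + (\<alpha> - w) * confF_par \<theta> \<alpha> w
           = confF_par (\<theta> - 1) (\<alpha> - 1) w) \<and>
    (w * deriv (confF_par \<theta> \<alpha>) w + \<alpha> * confF_par \<theta> \<alpha> w = confF_par (\<theta> + 1) (\<alpha> - 1) w) \<and>
    (deriv (confF_par \<theta> \<alpha>) w - confF_par \<theta> \<alpha> w
           = (- 1 + \<theta> - \<alpha>) / 2 * confF_par (\<theta> - 1) (\<alpha> + 1) w) \<and>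
    (w * deriv (confF_par \<theta> \<alpha>) w + (1 + \<theta> + \<alpha>) / 2 * confF_par \<theta> \<alpha> w
           = (1 + \<theta> + \<alpha>) / 2 * confF_par (\<theta> + 2) \<alpha> w) \<and>
    (w * deriv (confF_par \<theta> \<alpha>) w + ((1 - \<theta> + \<alpha>) / 2 - w) * confF_par \<theta> \<alpha> w
           = (1 - \<theta> + \<alpha>) / 2 * confF_par (\<theta> - 2) \<alpha> w)"
proof -
  define a where "a = (1 + \<alpha> + \<theta>) / 2"
  have \<theta>: "\<theta> = 2 * a - \<alpha> - 1"
    by (simp add: a_def field_simps)
  define F where "F x y = confF x y w" for x y
  \<comment> \<open>In the parameters (a, c) a shift of (\<theta>, \<alpha>) by (s, t) becomes a
    shift by ((s + t) / 2, t), so every function in the theorem is an F at integer shifts of (a,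
    \<alpha> + 1).\<close>
  have par: "confF_par (\<theta> + s) (\<alpha> + t) w = F (a + (s + t) / 2) (\<alpha> + 1 + t)" for s t
    by (simp add: confF_par_def F_def a_def add_divide_distrib add_ac)
  note shifts = par[of 0 0] par[of 1 1] par[of "-1" "-1"] par[of 1 "-1"] par[of "-1" 1]
    par[of 2 0] par[of "-2" 0]
  have "confF_par \<theta> \<alpha> = confF a (\<alpha> + 1)"
    by (simp add: fun_eq_iff confF_par_def a_def add_ac)
  then have D: "deriv (confF_par \<theta> \<alpha>) w = a * F (a + 1) (2 + \<alpha>)"
    by (simp add: deriv_confF F_def)
  have upper: "F (a + 1) (\<alpha> + 1) = F a (\<alpha> + 1) + w * F (a + 1) (2 + \<alpha>)"
    "F a \<alpha> = F (a - 1) \<alpha> + w * F a (\<alpha> + 1)"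
    using confF_contiguous_upper[of a "\<alpha> + 1" w] confF_contiguous_upper[of "a - 1" \<alpha> w]
    by (simp_all add: F_def)
  have lower: "a * F (a + 1) (2 + \<alpha>) = F a (\<alpha> + 1) + (a - \<alpha> - 1) * F a (2 + \<alpha>)"
    "a * F (a + 1) (\<alpha> + 1) = F a \<alpha> + (a - \<alpha>) * F a (\<alpha> + 1)"
    "(a - 1) * F a (\<alpha> + 1) = F (a - 1) \<alpha> + (a - 1 - \<alpha>) * F (a - 1) (\<alpha> + 1)"
    using confF_contiguous_lower[of a "\<alpha> + 1" w] confF_contiguous_lower[of a \<alpha> w]
      confF_contiguous_lower[of "a - 1" \<alpha> w]
    by (simp_all add: F_def algebra_simps)
  have coeffs: "(1 + \<theta> + \<alpha>) / 2 = a" "(- 1 + \<theta> - \<alpha>) / 2 = a - \<alpha> - 1"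
    "(1 - \<theta> + \<alpha>) / 2 = \<alpha> + 1 - a"
    by (simp_all add: \<theta> field_simps)
  \<comment> \<open>This removes the derivative from the four relations that contain w times it: a
    times the upper relation at (a, \<alpha> + 1).\<close>
  have wD: "w * (a * F (a + 1) (2 + \<alpha>)) = a * F (a + 1) (\<alpha> + 1) - a * F a (\<alpha> + 1)"
    using upper(1) by algebra
  have vals: "confF_par \<theta> \<alpha> w = F a (\<alpha> + 1)"
    "confF_par (\<theta> + 1) (\<alpha> + 1) w = F (a + 1) (2 + \<alpha>)"
    "confF_par (\<theta> - 1) (\<alpha> - 1) w = F (a - 1) \<alpha>"
    "confF_par (\<theta> + 1) (\<alpha> - 1) w = F a \<alpha>"
    "confF_par (\<theta> - 1) (\<alpha> + 1) w = F a (2 + \<alpha>)"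
    "confF_par (\<theta> + 2) \<alpha> w = F (a + 1) (\<alpha> + 1)"
    "confF_par (\<theta> - 2) \<alpha> w = F (a - 1) (\<alpha> + 1)"
    using shifts by simp_all
  \<comment> \<open>After unfolding, the first relation is an instance of reflexivity, left to the
    closing \<open>simp\<close>; the others are linear combinations of \<open>wD\<close>,
    \<open>upper\<close> and \<open>lower\<close>.\<close>
  show ?thesis
    unfolding D coeffs vals
  proof (intro conjI)
    show "w * (a * F (a + 1) (2 + \<alpha>)) + (\<alpha> - w) * F a (\<alpha> + 1) = F (a - 1) \<alpha>"
      using wD lower(2) upper(2) by algebra
    show "w * (a * F (a + 1) (2 + \<alpha>)) + \<alpha> * F a (\<alpha> + 1) = F a \<alpha>"
      using wD lower(2) by algebra
    show "a * F (a + 1) (2 + \<alpha>) - F a (\<alpha> + 1) = (a - \<alpha> - 1) * F a (2 + \<alpha>)"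
      using lower(1) by algebra
    show "w * (a * F (a + 1) (2 + \<alpha>)) + a * F a (\<alpha> + 1) = a * F (a + 1) (\<alpha> + 1)"
      using wD by algebra
    \<comment> \<open>As in the second relation, the left side becomes F (a - 1) \<alpha> + (1 - a)
      * F a (\<alpha> + 1), and \<open>lower(3)\<close> evaluates this.\<close>
    show "w * (a * F (a + 1) (2 + \<alpha>)) + (\<alpha> + 1 - a - w) * F a (\<alpha> + 1) =
        (\<alpha> + 1 - a) * F (a - 1) (\<alpha> + 1)"
      using wD lower(2,3) upper(2) by algebra
  qed simp
qed

end
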